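(* Let $m\ge 1$ be an integer, $0<\theta\le 1$ and $n\ge 0$ an integer, and consider the extended occupancy process with $m$ bins and probability parameter $\theta$. Let $\boldsymbol{u}_n=(u_1,\dots,u_n)$ be an outcome of $(U_1,\dots,U_n)$ having positive probability, and let $t$ be the corresponding value of the occupancy number $K_n$ (so $\boldsymbol{u}_n$ implies $K_n=t$). Then for every integer $r$, $$\mathbb{P}(K_{n+1}=r+t\mid (U_1,\dots,U_n)=\boldsymbol{u}_n)=\mathbb{P}(K_{n+1}=r+t\mid K_n=t)=\begin{cases}1-\theta(1-t/m) & r=0,\\ \theta(1-t/m) & r=1,\\ 0 & \text{otherwise.}\end{cases}$$ This conditional probability depends on the allocation history only through $K_n$, so $(K_n)_{n\ge 0}$ satisfies the Markov property, i.e. it is a Markov chain.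
   Context: Extended occupancy process: let $\tilde U_1,\tilde U_2,\dots$ be IID uniform on $\{1,\dots,m\}$ and $Q_1,Q_2,\dots$ be IID Bernoulli$(\theta)$, the two sequences independent of each other. Let $\bullet$ be a symbol not in $\{1,\dots,m\}$ and set $U_i=\bullet$ if $Q_i=0$ and $U_i=\tilde U_i$ if $Q_i=1$. Bin counts are $N_{n,\ell}=\sum_{i=1}^n\mathbb{I}(U_i=\ell)$ for $\ell=1,\dots,m$, and the occupancy number is $K_n=\sum_{\ell=1}^m\mathbb{I}(N_{n,\ell}>0)$, with $K_0=0$. *)

theory Defs
  imports "HOL-Probability.Probability"
begin

text \<open>
  An allocation is a sequence of type \<open>nat \<Rightarrow> nat option\<close>, read from index 1 on: \<open>Some l\<close> puts
  the ball into bin \<open>l\<close>, and \<open>None\<close> plays the role of the extra symbol outside \<open>{1..m}\<close>.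
\<close>

definition alloc :: "(nat \<Rightarrow> 'a \<Rightarrow> nat) \<Rightarrow> (nat \<Rightarrow> 'a \<Rightarrow> nat) \<Rightarrow> nat \<Rightarrow> 'a \<Rightarrow> nat option" where
  "alloc V Q i \<omega> = (if Q i \<omega> = 0 then None else Some (V i \<omega>))"

definition bin_count :: "(nat \<Rightarrow> nat option) \<Rightarrow> nat \<Rightarrow> nat \<Rightarrow> nat" where
  "bin_count u n l = (\<Sum>i = 1..n. of_bool (u i = Some l))"

definition occupancy :: "nat \<Rightarrow> (nat \<Rightarrow> nat option) \<Rightarrow> nat \<Rightarrow> nat" where
  "occupancy m u n = (\<Sum>l = 1..m. of_bool (bin_count u n l > 0))"

definition occ_number ::
    "nat \<Rightarrow> (nat \<Rightarrow> 'a \<Rightarrow> nat) \<Rightarrow> (nat \<Rightarrow> 'a \<Rightarrow> nat) \<Rightarrow> nat \<Rightarrow> 'a \<Rightarrow> nat" where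
  "occ_number m V Q n \<omega> = occupancy m (\<lambda>i. alloc V Q i \<omega>) n"

text \<open>
  \<open>V\<close> is the IID uniform sequence on the bins and \<open>Q\<close> the IID Bernoulli sequence (with values in
  \<open>{0, 1}\<close> almost surely; both are \<open>nat\<close>-valued because \<open>indep_var\<close> needs equal value types).
  The last assumption is independence of the two sequences as whole processes.
\<close>

locale extended_occupancy_process = prob_space M
  for M :: "'a measure" +
  fixes m :: nat and \<theta> :: real
    and V :: "nat \<Rightarrow> 'a \<Rightarrow> nat" and Q :: "nat \<Rightarrow> 'a \<Rightarrow> nat"
  assumes indep_V: "indep_vars (\<lambda>_. count_space UNIV) V {1..}"
    and distr_V: "\<And>i. i \<ge> 1 \<Longrightarrow> distr M (count_space UNIV) (V i) = measure_pmf (pmf_of_set {1..m})"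
    and indep_Q: "indep_vars (\<lambda>_. count_space UNIV) Q {1..}"
    and distr_Q: "\<And>i. i \<ge> 1 \<Longrightarrow> distr M (count_space UNIV) (Q i) =
      measure_pmf (map_pmf of_bool (bernoulli_pmf \<theta>))"
    and indep_V_Q: "indep_var
      (Pi\<^sub>M {1..} (\<lambda>_. count_space UNIV)) (\<lambda>\<omega>. \<lambda>i\<in>{1..}. V i \<omega>)
      (Pi\<^sub>M {1..} (\<lambda>_. count_space UNIV)) (\<lambda>\<omega>. \<lambda>i\<in>{1..}. Q i \<omega>)"

text \<open>Discrete-time Markov chains with a countable state space; not necessarily homogeneous.\<close>

definition markov_chain :: "'a measure \<Rightarrow> (nat \<Rightarrow> 'a \<Rightarrow> 'b::countable) \<Rightarrow> bool" where
  "markov_chain M X \<longleftrightarrow>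
     prob_space M \<and>
     (\<forall>n. X n \<in> measurable M (count_space UNIV)) \<and>
     (\<forall>n x y. measure M {\<omega> \<in> space M. \<forall>i\<le>n. X i \<omega> = x i} > 0 \<longrightarrow>
        \<P>(\<omega> in M. X (Suc n) \<omega> = y \<bar> \<forall>i\<le>n. X i \<omega> = x i) =
        \<P>(\<omega> in M. X (Suc n) \<omega> = y \<bar> X n \<omega> = x n))"

end

theory Submission imports Defs begin

text \<open>After \<open>n\<close> balls with \<open>t\<close> bins occupied, \<open>m - t\<close>
  bins are empty, whatever the history. The next allocation is independent of the history and hits
  each given bin with probability \<open>\<theta> / m\<close>, so the occupancy number grows by one
  with probability \<open>\<theta> * (1 - t / m)\<close> and otherwise stays the same.

  The argument is run once, in \<open>cond_prob_history\<close>, for an arbitrary event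
  \<open>P\<close> of positive probability that is determined by the first \<open>n\<close>
  allocations and on which the occupancy number is constantly \<open>t\<close>. The answer depends
  on \<open>P\<close> only through \<open>t\<close>. Taking for \<open>P\<close> a single allocation
  history, the event that the occupancy number at time \<open>n\<close> is \<open>t\<close>, or a
  whole path of occupancy numbers gives the two conditional probabilities of the theorem and the
  Markov property.

  The probabilistic input is \<open>prob_history_alloc\<close>, which rests on the independence of
  the allocations (\<open>indep_alloc\<close>, through \<open>indep_vars_Pair\<close>) and on their
  law (\<open>prob_alloc\<close>). The sum over the empty bins is carried out in
  \<open>prob_history_new_bin\<close>.\<close>

section \<open>Independence of pairs formed from two independent families\<close>

text \<open>Probabilities of rectangles factor: first between the two processes by
  \<open>XY\<close>, then within each process over the indices. The preimages of rectangles form an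
  intersection-stable generator of the sigma-algebra of each pair, so independence extends from them
  to all measurable sets.\<close>

lemma (in prob_space) indep_vars_Pair:
  assumes X: "indep_vars M' X I" and Y: "indep_vars N' Y I"
    and XY: "indep_var (Pi\<^sub>M I M') (\<lambda>\<omega>. \<lambda>i\<in>I. X i \<omega>) (Pi\<^sub>M I N') (\<lambda>\<omega>. \<lambda>i\<in>I. Y i \<omega>)"
  shows "indep_vars (\<lambda>i. M' i \<Otimes>\<^sub>M N' i) (\<lambda>i \<omega>. (X i \<omega>, Y i \<omega>)) I"
proof -
  have rv [measurable]: "\<And>i. i \<in> I \<Longrightarrow> X i \<in> M \<rightarrow>\<^sub>M M' i" "\<And>i. i \<in> I \<Longrightarrow> Y i \<in> M \<rightarrow>\<^sub>M N' i"
    using X Y by (auto simp: indep_vars_def2)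
  define R where "R i = {X i -` A \<inter> Y i -` B \<inter> space M | A B. A \<in> sets (M' i) \<and> B \<in> sets (N' i)}" for i
  have prob_rect: "prob (\<Inter>j\<in>J. X j -` A j \<inter> Y j -` B j \<inter> space M) =
      (\<Prod>j\<in>J. prob (X j -` A j \<inter> space M)) * (\<Prod>j\<in>J. prob (Y j -` B j \<inter> space M))"
    if J: "J \<subseteq> I" "finite J" "J \<noteq> {}"
      and A: "\<And>j. j \<in> J \<Longrightarrow> A j \<in> sets (M' j)" and B: "\<And>j. j \<in> J \<Longrightarrow> B j \<in> sets (N' j)"
    for J A B
  proof -
    \<comment> \<open>\<open>XY\<close> speaks only of the whole processes, so the events over the
      finite set \<open>J\<close> are written as preimages of cylinders over
      \<open>I\<close>.\<close>
    let ?A = "prod_emb I M' J (Pi\<^sub>E J A)" and ?B = "prod_emb I N' J (Pi\<^sub>E J B)"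
    have vim: "(\<lambda>\<omega>. \<lambda>i\<in>I. X i \<omega>) -` ?A \<inter> space M = (\<Inter>j\<in>J. X j -` A j \<inter> space M)"
         "(\<lambda>\<omega>. \<lambda>i\<in>I. Y i \<omega>) -` ?B \<inter> space M = (\<Inter>j\<in>J. Y j -` B j \<inter> space M)"
      using J measurable_space[OF rv(1)] measurable_space[OF rv(2)]
      by (auto simp: prod_emb_PiE sets.sets_into_space A B prod_emb_def PiE_iff subset_iff
            split: if_splits)
    have "(\<Inter>j\<in>J. X j -` A j \<inter> Y j -` B j \<inter> space M) =
        (\<Inter>j\<in>J. X j -` A j \<inter> space M) \<inter> (\<Inter>j\<in>J. Y j -` B j \<inter> space M)"
      by auto
    also have "\<dots> = (\<lambda>\<omega>. (\<lambda>i\<in>I. X i \<omega>, \<lambda>i\<in>I. Y i \<omega>)) -` (?A \<times> ?B) \<inter> space M"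
      unfolding vim[symmetric] by auto
    also have "prob \<dots> = prob (\<Inter>j\<in>J. X j -` A j \<inter> space M) * prob (\<Inter>j\<in>J. Y j -` B j \<inter> space M)"
      unfolding vim[symmetric] using J A B by (intro indep_varD[OF XY] sets_PiM_I) auto
    finally show ?thesis
      by (simp only: indep_varsD[OF X J(3,2,1) A] indep_varsD[OF Y J(3,2,1) B])
  qed
  have "indep_sets R I"
  proof (rule indep_setsI)
    fix i assume i: "i \<in> I"
    have "X i -` A \<inter> Y i -` B \<inter> space M \<in> events" if "A \<in> sets (M' i)" "B \<in> sets (N' i)" for A B
    proof -
      have "X i -` A \<inter> Y i -` B \<inter> space M = (X i -` A \<inter> space M) \<inter> (Y i -` B \<inter> space M)" by blast
      also have "\<dots> \<in> events"
        using i that by (intro sets.Int measurable_sets[OF rv(1)] measurable_sets[OF rv(2)])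
      finally show ?thesis .
    qed
    then show "R i \<subseteq> events" unfolding R_def by blast
  next
    fix E J assume J: "J \<noteq> {}" "J \<subseteq> I" "finite J" and "\<forall>j\<in>J. E j \<in> R j"
    then have "\<forall>j\<in>J. \<exists>A B. E j = X j -` A \<inter> Y j -` B \<inter> space M \<and> A \<in> sets (M' j) \<and> B \<in> sets (N' j)"
      by (auto simp: R_def)
    then obtain A B where AB: "\<And>j. j \<in> J \<Longrightarrow> E j = X j -` A j \<inter> Y j -` B j \<inter> space M"
        "\<And>j. j \<in> J \<Longrightarrow> A j \<in> sets (M' j)" "\<And>j. j \<in> J \<Longrightarrow> B j \<in> sets (N' j)"
      by metis
    \<comment> \<open>The singleton case splits each factor \<open>prob (E j)\<close>, so that the
      two products over \<open>J\<close> can be merged into one.\<close>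
    have "prob (E j) = prob (X j -` A j \<inter> space M) * prob (Y j -` B j \<inter> space M)" if "j \<in> J" for j
      using prob_rect[of "{j}" A B] that J AB by auto
    moreover have "prob (\<Inter>j\<in>J. E j) =
        (\<Prod>j\<in>J. prob (X j -` A j \<inter> space M)) * (\<Prod>j\<in>J. prob (Y j -` B j \<inter> space M))"
      using prob_rect[of J A B] J AB by simp
    ultimately show "prob (\<Inter>j\<in>J. E j) = (\<Prod>j\<in>J. prob (E j))"
      by (simp add: prod.distrib)
  qed
  moreover have "Int_stable (R i)" for i
  proof (rule Int_stableI)
    fix a b assume "a \<in> R i" "b \<in> R i"
    then obtain A B C D where *: "a = X i -` A \<inter> Y i -` B \<inter> space M" "b = X i -` C \<inter> Y i -` D \<inter> space M"
      "A \<in> sets (M' i)" "C \<in> sets (M' i)" "B \<in> sets (N' i)" "D \<in> sets (N' i)"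
      by (auto simp: R_def)
    then have "a \<inter> b = X i -` (A \<inter> C) \<inter> Y i -` (B \<inter> D) \<inter> space M" by auto
    with * show "a \<inter> b \<in> R i" unfolding R_def by blast
  qed
  ultimately have "indep_sets (\<lambda>i. sigma_sets (space M) (R i)) I"
    by (rule indep_sets_sigma)
  moreover have "{(\<lambda>\<omega>. (X i \<omega>, Y i \<omega>)) -` A \<inter> space M | A. A \<in> sets (M' i \<Otimes>\<^sub>M N' i)}
      \<subseteq> sigma_sets (space M) (R i)" if i: "i \<in> I" for i
  proof -
    let ?rect = "{A \<times> B | A B. A \<in> sets (M' i) \<and> B \<in> sets (N' i)}"
    \<comment> \<open>Generating a sigma-algebra commutes with taking preimages, so only preimages
      of rectangles have to be placed in \<open>R i\<close>.\<close>
    have "(\<lambda>\<omega>. (X i \<omega>, Y i \<omega>)) \<in> space M \<rightarrow> space (M' i) \<times> space (N' i)"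
      using measurable_space[OF rv(1)[OF i]] measurable_space[OF rv(2)[OF i]] by auto
    then have "{(\<lambda>\<omega>. (X i \<omega>, Y i \<omega>)) -` A \<inter> space M | A. A \<in> sets (M' i \<Otimes>\<^sub>M N' i)} =
        sigma_sets (space M) {(\<lambda>\<omega>. (X i \<omega>, Y i \<omega>)) -` A \<inter> space M | A. A \<in> ?rect}"
      unfolding sets_pair_measure by (rule sigma_sets_vimage_commute)
    also have "\<dots> \<subseteq> sigma_sets (space M) (R i)"
    proof (rule sigma_sets_subseteq, safe)
      fix A B assume "A \<in> sets (M' i)" "B \<in> sets (N' i)"
      then show "(\<lambda>\<omega>. (X i \<omega>, Y i \<omega>)) -` (A \<times> B) \<inter> space M \<in> R i"
        unfolding R_def by (intro CollectI exI[of _ A] exI[of _ B]) auto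
    qed
    finally show ?thesis .
  qed
  ultimately have "indep_sets (\<lambda>i. {(\<lambda>\<omega>. (X i \<omega>, Y i \<omega>)) -` A \<inter> space M | A. A \<in> sets (M' i \<Otimes>\<^sub>M N' i)}) I"
    by (rule indep_sets_mono_sets)
  then show ?thesis
    by (simp add: indep_vars_def2)
qed

section \<open>Deterministic counting of occupied bins\<close>

lemma bin_count_cong: "(\<And>i. i \<in> {1..n} \<Longrightarrow> u i = v i) \<Longrightarrow> bin_count u n l = bin_count v n l"
  by (simp add: bin_count_def)

lemma occupancy_cong: "(\<And>i. i \<in> {1..n} \<Longrightarrow> u i = v i) \<Longrightarrow> occupancy m u n = occupancy m v n"
  using bin_count_cong[of n u v] by (simp add: occupancy_def)

lemma bin_count_Suc: "bin_count u (Suc n) l = bin_count u n l + of_bool (u (Suc n) = Some l)"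
  by (simp add: bin_count_def)

lemma occupancy_eq_card: "occupancy m u n = card {l \<in> {1..m}. bin_count u n l > 0}"
  by (simp add: occupancy_def Int_def flip: of_bool_def sum.inter_filter)

lemma card_empty_bins:
  "real (card {l \<in> {1..m}. bin_count u n l = 0}) = real m - real (occupancy m u n)"
proof -
  have "card ({l \<in> {1..m}. bin_count u n l = 0} \<union> {l \<in> {1..m}. bin_count u n l > 0}) =
      card {l \<in> {1..m}. bin_count u n l = 0} + card {l \<in> {1..m}. bin_count u n l > 0}"
    by (rule card_Un_disjoint) auto
  moreover have "{l \<in> {1..m}. bin_count u n l = 0} \<union> {l \<in> {1..m}. bin_count u n l > 0} = {1..m}"
    by auto
  ultimately show ?thesis by (simp add: occupancy_eq_card)
qed

text \<open>Only the bin receiving the new ball changes its count, and it becomes newly occupied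
  only if it was empty. The value \<open>None\<close> and values outside \<open>{1..m}\<close>,
  which \<open>V\<close> avoids only almost surely, leave the occupancy unchanged.\<close>

lemma occupancy_Suc:
  "occupancy m u (Suc n) =
     occupancy m u n + of_bool (\<exists>l\<in>{1..m}. bin_count u n l = 0 \<and> u (Suc n) = Some l)"
proof (cases "\<exists>l\<in>{1..m}. bin_count u n l = 0 \<and> u (Suc n) = Some l")
  case True
  then obtain l where "l \<in> {1..m}" "bin_count u n l = 0" "u (Suc n) = Some l" by blast
  moreover from this have "{k \<in> {1..m}. bin_count u (Suc n) k > 0} =
      insert l {k \<in> {1..m}. bin_count u n k > 0}"
    by (auto simp: bin_count_Suc)
  ultimately show ?thesis by (auto simp: occupancy_eq_card)
next
  case False
  then have "{k \<in> {1..m}. bin_count u (Suc n) k > 0} = {k \<in> {1..m}. bin_count u n k > 0}"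
    by (auto simp: bin_count_Suc)
  with False show ?thesis by (simp add: occupancy_eq_card)
qed

section \<open>Independence and law of the allocations, events of the history\<close>

context extended_occupancy_process
begin

abbreviation U :: "'a \<Rightarrow> nat \<Rightarrow> nat option" where
  "U \<omega> i \<equiv> alloc V Q i \<omega>"

lemma indep_pairs:
  "indep_vars (\<lambda>_. count_space UNIV \<Otimes>\<^sub>M count_space UNIV) (\<lambda>i \<omega>. (V i \<omega>, Q i \<omega>)) {1..}"
  using indep_vars_Pair[OF indep_V indep_Q indep_V_Q] .

text \<open>Each allocation is a function of the pair \<open>(V i, Q i)\<close>; its measurability
  is automatic because the product of the two countable discrete spaces is discrete.\<close>

lemma indep_alloc: "indep_vars (\<lambda>_. count_space UNIV) (alloc V Q) {1..}"
proof -
  have "indep_vars (\<lambda>_. count_space UNIV)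
      (\<lambda>i \<omega>. (\<lambda>(v, q). if q = 0 then None else Some v) (V i \<omega>, Q i \<omega>)) {1..}"
    by (rule indep_vars_compose2[OF indep_pairs]) (simp add: pair_measure_countable)
  also have "(\<lambda>i \<omega>. (\<lambda>(v, q). if q = 0 then None else Some v) (V i \<omega>, Q i \<omega>)) = alloc V Q"
    by (simp add: alloc_def fun_eq_iff)
  finally show ?thesis .
qed

text \<open>The event is the intersection of \<open>V i = l\<close>, of probability
  \<open>1 / m\<close>, and \<open>Q i \<noteq> 0\<close>, of probability \<open>\<theta>\<close>,
  and these two are independent.\<close>

lemma prob_alloc:
  assumes "i \<ge> 1" "l \<in> {1..m}" "0 \<le> \<theta>" "\<theta> \<le> 1"
  shows "prob {\<omega> \<in> space M. alloc V Q i \<omega> = Some l} = \<theta> / real m"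
proof -
  have rv: "V i \<in> M \<rightarrow>\<^sub>M count_space UNIV" "Q i \<in> M \<rightarrow>\<^sub>M count_space UNIV"
    using indep_V indep_Q assms by (auto simp: indep_vars_def2)
  \<comment> \<open>Independence of \<open>V\<close> and \<open>Q\<close> is given for whole
    processes, hence the one-coordinate events are phrased as sets of sequences.\<close>
  let ?A = "{f \<in> space (Pi\<^sub>M {1..} (\<lambda>_. count_space UNIV)). f i = l}"
  let ?B = "{f \<in> space (Pi\<^sub>M {1..} (\<lambda>_. count_space UNIV)). f i \<noteq> (0::nat)}"
  have ev: "?A \<in> sets (Pi\<^sub>M {1..} (\<lambda>_. count_space UNIV))" "?B \<in> sets (Pi\<^sub>M {1..} (\<lambda>_. count_space UNIV))"
    using assms by (intro sets_Collect_single'; simp)+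
  have "{\<omega> \<in> space M. alloc V Q i \<omega> = Some l} =
     (\<lambda>\<omega>. (\<lambda>i\<in>{1..}. V i \<omega>, \<lambda>i\<in>{1..}. Q i \<omega>)) -` (?A \<times> ?B) \<inter> space M"
    using assms by (auto simp: alloc_def space_PiM)
  then have "prob {\<omega> \<in> space M. alloc V Q i \<omega> = Some l} =
      prob ((\<lambda>\<omega>. \<lambda>i\<in>{1..}. V i \<omega>) -` ?A \<inter> space M) *
      prob ((\<lambda>\<omega>. \<lambda>i\<in>{1..}. Q i \<omega>) -` ?B \<inter> space M)"
    by (simp only: indep_varD[OF indep_V_Q ev])
  moreover have "(\<lambda>\<omega>. \<lambda>i\<in>{1..}. V i \<omega>) -` ?A \<inter> space M = V i -` {l} \<inter> space M"
    using assms(1) by (auto simp: space_PiM)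
  moreover have "(\<lambda>\<omega>. \<lambda>i\<in>{1..}. Q i \<omega>) -` ?B \<inter> space M = Q i -` (-{0}) \<inter> space M"
    using assms(1) by (auto simp: space_PiM)
  moreover have "prob (V i -` {l} \<inter> space M) = 1 / real m"
  proof -
    have "prob (V i -` {l} \<inter> space M) = measure (distr M (count_space UNIV) (V i)) {l}"
      by (simp add: measure_distr rv)
    also have "\<dots> = pmf (pmf_of_set {1..m}) l"
      by (simp only: distr_V[OF assms(1)] measure_pmf_single)
    also have "\<dots> = 1 / real m"
      using assms(2) by (subst pmf_of_set) auto
    finally show ?thesis .
  qed
  moreover have "prob (Q i -` (-{0}) \<inter> space M) = \<theta>"
  proof -
    have "prob (Q i -` (-{0}) \<inter> space M) = measure (distr M (count_space UNIV) (Q i)) (-{0})"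
      by (simp add: measure_distr rv)
    also have "\<dots> = measure (measure_pmf (bernoulli_pmf \<theta>)) (of_bool -` (-{0 :: nat}))"
      by (simp only: distr_Q[OF assms(1)] measure_map_pmf)
    also have "of_bool -` (-{0 :: nat}) = {True}"
      by auto
    also have "measure (measure_pmf (bernoulli_pmf \<theta>)) {True} = \<theta>"
      using assms(3,4) by (simp add: measure_pmf_single)
    finally show ?thesis .
  qed
  ultimately show ?thesis by simp
qed

text \<open>The assumption says that \<open>P\<close> looks only at the first \<open>n\<close>
  allocations. Finitely many coordinates with countably many values give a discrete product space,
  so every such \<open>P\<close> defines an event of the history.\<close>

lemma sets_history:
  assumes "\<And>u v. (\<And>i. i \<in> {1..n} \<Longrightarrow> u i = v i) \<Longrightarrow> P u = P v"
  shows "{\<omega> \<in> space M. P (U \<omega>)} \<in> events"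
    and "{u \<in> space (Pi\<^sub>M {1..n} (\<lambda>_. count_space UNIV)). P u} \<in> sets (Pi\<^sub>M {1..n} (\<lambda>_. count_space UNIV))"
    and "{\<omega> \<in> space M. P (U \<omega>)} = (\<lambda>\<omega>. \<lambda>i\<in>{1..n}. U \<omega> i) -`
       {u \<in> space (Pi\<^sub>M {1..n} (\<lambda>_. count_space UNIV)). P u} \<inter> space M"
proof -
  have "Pi\<^sub>M {1..n} (\<lambda>_. count_space (UNIV :: nat option set)) = count_space (Pi\<^sub>E {1..n} (\<lambda>_. UNIV))"
    by (rule count_space_PiM_finite) auto
  then show s: "{u \<in> space (Pi\<^sub>M {1..n} (\<lambda>_. count_space UNIV)). P u} \<in> sets (Pi\<^sub>M {1..n} (\<lambda>_. count_space UNIV))"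
    by auto
  \<comment> \<open>Cutting a sequence down to \<open>{1..n}\<close> does not affect
    \<open>P\<close>; thus the event is a preimage under the restricted process.\<close>
  have "P (restrict u {1..n}) = P u" for u
    by (rule assms) simp
  then show v: "{\<omega> \<in> space M. P (U \<omega>)} = (\<lambda>\<omega>. \<lambda>i\<in>{1..n}. U \<omega> i) -`
       {u \<in> space (Pi\<^sub>M {1..n} (\<lambda>_. count_space UNIV)). P u} \<inter> space M"
    by (auto simp: space_PiM)
  have "(\<lambda>\<omega>. \<lambda>i\<in>{1..n}. U \<omega> i) \<in> M \<rightarrow>\<^sub>M Pi\<^sub>M {1..n} (\<lambda>_. count_space UNIV)"
    using indep_alloc by (intro measurable_restrict) (auto simp: indep_vars_def2)
  then show "{\<omega> \<in> space M. P (U \<omega>)} \<in> events"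
    unfolding v using s by (rule measurable_sets)
qed

section \<open>One step of the process given its history\<close>

text \<open>The index blocks \<open>{1..n}\<close> and \<open>{Suc n}\<close> are disjoint, so the
  history and the next allocation are independent random vectors.\<close>

lemma prob_history_alloc:
  assumes P: "\<And>u v. (\<And>i. i \<in> {1..n} \<Longrightarrow> u i = v i) \<Longrightarrow> P u = P v"
    and l: "l \<in> {1..m}" "0 \<le> \<theta>" "\<theta> \<le> 1"
  shows "prob {\<omega> \<in> space M. P (U \<omega>) \<and> U \<omega> (Suc n) = Some l} =
    prob {\<omega> \<in> space M. P (U \<omega>)} * (\<theta> / real m)"
proof -
  let ?N = "\<lambda>I. Pi\<^sub>M I (\<lambda>_. count_space (UNIV :: nat option set))"
  let ?A = "{u \<in> space (?N {1..n}). P u}" and ?B = "{u \<in> space (?N {Suc n}). u (Suc n) = Some l}"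
  have B: "(\<lambda>\<omega>. \<lambda>i\<in>{Suc n}. U \<omega> i) -` ?B \<inter> space M = {\<omega> \<in> space M. alloc V Q (Suc n) \<omega> = Some l}"
    by (auto simp: space_PiM)
  have "indep_var (?N {1..n}) (\<lambda>\<omega>. \<lambda>i\<in>{1..n}. U \<omega> i) (?N {Suc n}) (\<lambda>\<omega>. \<lambda>i\<in>{Suc n}. U \<omega> i)"
    by (rule indep_var_restrict[OF indep_alloc]) auto
  moreover have "?A \<in> sets (?N {1..n})"
    by (rule sets_history(2)[OF P])
  moreover have "?B \<in> sets (?N {Suc n})"
    by measurable
  ultimately have "prob ((\<lambda>\<omega>. (\<lambda>i\<in>{1..n}. U \<omega> i, \<lambda>i\<in>{Suc n}. U \<omega> i)) -` (?A \<times> ?B) \<inter> space M) =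
      prob ((\<lambda>\<omega>. \<lambda>i\<in>{1..n}. U \<omega> i) -` ?A \<inter> space M) *
      prob ((\<lambda>\<omega>. \<lambda>i\<in>{Suc n}. U \<omega> i) -` ?B \<inter> space M)"
    by (rule indep_varD)
  also have "(\<lambda>\<omega>. (\<lambda>i\<in>{1..n}. U \<omega> i, \<lambda>i\<in>{Suc n}. U \<omega> i)) -` (?A \<times> ?B) \<inter> space M =
      ((\<lambda>\<omega>. \<lambda>i\<in>{1..n}. U \<omega> i) -` ?A \<inter> space M) \<inter> ((\<lambda>\<omega>. \<lambda>i\<in>{Suc n}. U \<omega> i) -` ?B \<inter> space M)"
    by auto
  also have "(\<lambda>\<omega>. \<lambda>i\<in>{1..n}. U \<omega> i) -` ?A \<inter> space M = {\<omega> \<in> space M. P (U \<omega>)}"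
    by (rule sets_history(3)[OF P, symmetric])
  finally have "prob ({\<omega> \<in> space M. P (U \<omega>)} \<inter> {\<omega> \<in> space M. alloc V Q (Suc n) \<omega> = Some l}) =
      prob {\<omega> \<in> space M. P (U \<omega>)} * (\<theta> / real m)"
    unfolding B using prob_alloc[of "Suc n" l] l by simp
  moreover have "{\<omega> \<in> space M. P (U \<omega>)} \<inter> {\<omega> \<in> space M. alloc V Q (Suc n) \<omega> = Some l} =
      {\<omega> \<in> space M. P (U \<omega>) \<and> U \<omega> (Suc n) = Some l}"
    by auto
  ultimately show ?thesis by simp
qed

text \<open>
  Splitting over the bin of the new ball, the sum over \<open>l\<close> of the probabilities of \<open>P\<close> together
  with emptiness of bin \<open>l\<close> is the expected number of empty bins on \<open>P\<close>, namely
  \<open>m - t\<close> times the probability of \<open>P\<close>.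
\<close>

lemma prob_history_new_bin:
  assumes P: "\<And>u v. (\<And>i. i \<in> {1..n} \<Longrightarrow> u i = v i) \<Longrightarrow> P u = P v"
    and t: "\<And>u. P u \<Longrightarrow> occupancy m u n = t"
    and m: "m \<ge> 1" and \<theta>: "0 \<le> \<theta>" "\<theta> \<le> 1"
  shows "prob {\<omega> \<in> space M. P (U \<omega>) \<and> occupancy m (U \<omega>) (Suc n) = Suc t} =
    prob {\<omega> \<in> space M. P (U \<omega>)} * (\<theta> * (1 - real t / real m))"
proof -
  let ?P = "\<lambda>l u. P u \<and> bin_count u n l = 0"
  let ?E = "\<lambda>l. {\<omega> \<in> space M. ?P l (U \<omega>)}"
  let ?F = "\<lambda>l. {\<omega> \<in> space M. ?P l (U \<omega>) \<and> U \<omega> (Suc n) = Some l}"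
  have Pl: "?P l u = ?P l v" if "\<And>i. i \<in> {1..n} \<Longrightarrow> u i = v i" for u v l
    using P[OF that] bin_count_cong[OF that] by simp
  have ev: "{\<omega> \<in> space M. P (U \<omega>)} \<in> events"
    by (rule sets_history(1)[OF P])
  have evE: "?E l \<in> events" for l
    by (rule sets_history(1)[OF Pl])
  \<comment> \<open>This event also looks at the new ball, so it belongs to the history up to
    \<open>Suc n\<close>.\<close>
  have evF: "?F l \<in> events" for l
  proof (rule sets_history(1)[of "Suc n"])
    fix u v :: "nat \<Rightarrow> nat option" assume "\<And>i. i \<in> {1..Suc n} \<Longrightarrow> u i = v i"
    with Pl[of u v l] show "(?P l u \<and> u (Suc n) = Some l) = (?P l v \<and> v (Suc n) = Some l)" by simp
  qed
  have "(\<Sum>l\<in>{1..m}. prob (?E l)) = (\<Sum>l\<in>{1..m}. expectation (indicator (?E l)))"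
    using evE by simp
  also have "\<dots> = expectation (\<lambda>\<omega>. \<Sum>l\<in>{1..m}. indicator (?E l) \<omega>)"
    using evE by (intro Bochner_Integration.integral_sum[symmetric]) (simp add: emeasure_eq_measure)
  also have "\<dots> = expectation (\<lambda>\<omega>. (real m - real t) * indicator {\<omega> \<in> space M. P (U \<omega>)} \<omega>)"
  proof (rule Bochner_Integration.integral_cong[OF refl])
    fix \<omega> assume "\<omega> \<in> space M"
    then have "(\<Sum>l\<in>{1..m}. indicator (?E l) \<omega>) =
        of_bool (P (U \<omega>)) * real (card {l \<in> {1..m}. bin_count (U \<omega>) n l = 0})"
      by (simp add: indicator_def Int_def flip: of_bool_def)
    with \<open>\<omega> \<in> space M\<close> show "(\<Sum>l\<in>{1..m}. indicator (?E l) \<omega>) =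
        (real m - real t) * indicator {\<omega> \<in> space M. P (U \<omega>)} \<omega>"
      using card_empty_bins[of m "U \<omega>" n] t[of "U \<omega>"] by (cases "P (U \<omega>)") auto
  qed
  also have "\<dots> = (real m - real t) * prob {\<omega> \<in> space M. P (U \<omega>)}"
    using ev by simp
  finally have sum: "(\<Sum>l\<in>{1..m}. prob (?E l)) = (real m - real t) * prob {\<omega> \<in> space M. P (U \<omega>)}" .
  \<comment> \<open>On \<open>P\<close> the occupancy rises exactly when the new ball lands in some
    bin that was empty. The pieces are disjoint because a ball lands in at most one bin.\<close>
  have new: "{\<omega> \<in> space M. P (U \<omega>) \<and> occupancy m (U \<omega>) (Suc n) = Suc t} = (\<Union>l\<in>{1..m}. ?F l)"
    using t by (auto simp: occupancy_Suc split: if_splits)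
  have "prob {\<omega> \<in> space M. P (U \<omega>) \<and> occupancy m (U \<omega>) (Suc n) = Suc t} =
      (\<Sum>l\<in>{1..m}. prob (?F l))"
    unfolding new
    by (rule finite_measure_finite_Union) (use evF in \<open>auto simp: disjoint_family_on_def\<close>)
  also have "\<dots> = (\<Sum>l\<in>{1..m}. prob (?E l) * (\<theta> / real m))"
  proof (rule sum.cong[OF refl])
    fix l assume "l \<in> {1..m}"
    show "prob (?F l) = prob (?E l) * (\<theta> / real m)"
      by (rule prob_history_alloc[where P = "?P l"]) (fact Pl \<open>l \<in> {1..m}\<close> \<theta>)+
  qed
  also have "\<dots> = (real m - real t) * prob {\<omega> \<in> space M. P (U \<omega>)} * (\<theta> / real m)"
    by (simp only: sum_distrib_right[symmetric] sum)
  finally show ?thesis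
    using m by (simp add: field_simps)
qed

text \<open>The value does not mention \<open>P\<close> beyond \<open>t\<close>; this is the source
  of the Markov property. Keeping \<open>P\<close> general lets one computation serve every
  conditioning event.\<close>

lemma cond_prob_history:
  assumes P: "\<And>u v. (\<And>i. i \<in> {1..n} \<Longrightarrow> u i = v i) \<Longrightarrow> P u = P v"
    and t: "\<And>u. P u \<Longrightarrow> occupancy m u n = t"
    and m: "m \<ge> 1" and \<theta>: "0 \<le> \<theta>" "\<theta> \<le> 1"
    and pos: "prob {\<omega> \<in> space M. P (U \<omega>)} > 0"
  shows "\<P>(\<omega> in M. int (occ_number m V Q (Suc n) \<omega>) = r + int t \<bar> P (U \<omega>)) =
     (if r = 0 then 1 - \<theta> * (1 - real t / real m)
      else if r = 1 then \<theta> * (1 - real t / real m) else 0)"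
proof -
  let ?H = "{\<omega> \<in> space M. P (U \<omega>)}"
  let ?New = "{\<omega> \<in> space M. P (U \<omega>) \<and> occupancy m (U \<omega>) (Suc n) = Suc t}"
  let ?E = "{\<omega> \<in> space M. int (occ_number m V Q (Suc n) \<omega>) = r + int t \<and> P (U \<omega>)}"
  have evH: "?H \<in> events"
    by (rule sets_history(1)[OF P])
  have evN: "?New \<in> events"
  proof (rule sets_history(1)[of "Suc n"])
    fix u v :: "nat \<Rightarrow> nat option" assume "\<And>i. i \<in> {1..Suc n} \<Longrightarrow> u i = v i"
    with P[of u v] occupancy_cong[of "Suc n" u v m]
    show "(P u \<and> occupancy m u (Suc n) = Suc t) = (P v \<and> occupancy m v (Suc n) = Suc t)" by simp
  qed
  have new: "prob ?New = prob ?H * (\<theta> * (1 - real t / real m))"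
    by (rule prob_history_new_bin[OF P t m \<theta>])
  \<comment> \<open>One ball raises the occupancy by 0 or 1: growth is \<open>?New\<close>, no
    growth is its complement within \<open>?H\<close>, and any other integer \<open>r\<close>,
    negative ones included, gives the empty event.\<close>
  have E: "?E = (if r = 0 then ?H - ?New else if r = 1 then ?New else {})"
    using t by (auto simp: occ_number_def occupancy_Suc)
  have "prob ?E = prob ?H *
      (if r = 0 then 1 - \<theta> * (1 - real t / real m)
       else if r = 1 then \<theta> * (1 - real t / real m) else 0)"
    unfolding E using new finite_measure_Diff[OF evH evN] by (auto simp: right_diff_distrib)
  with pos show ?thesis
    by (simp add: cond_prob_def)
qed

section \<open>The occupancy number as a Markov chain\<close>

lemma measurable_occ_number: "occ_number m V Q n \<in> M \<rightarrow>\<^sub>M count_space UNIV"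
proof (rule measurableI)
  fix A :: "nat set"
  have "{\<omega> \<in> space M. occupancy m (U \<omega>) n \<in> A} \<in> events"
  proof (rule sets_history(1)[of n])
    fix u v :: "nat \<Rightarrow> nat option" assume "\<And>i. i \<in> {1..n} \<Longrightarrow> u i = v i"
    then show "(occupancy m u n \<in> A) = (occupancy m v n \<in> A)"
      using occupancy_cong[of n u v m] by simp
  qed
  also have "{\<omega> \<in> space M. occupancy m (U \<omega>) n \<in> A} = occ_number m V Q n -` A \<inter> space M"
    by (auto simp: occ_number_def)
  finally show "occ_number m V Q n -` A \<inter> space M \<in> events" .
qed simp

lemma cond_prob_occ_number:
  assumes "m \<ge> 1" "0 \<le> \<theta>" "\<theta> \<le> 1"
    and "prob {\<omega> \<in> space M. occ_number m V Q n \<omega> = t} > 0"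
  shows "\<P>(\<omega> in M. int (occ_number m V Q (Suc n) \<omega>) = r + int t \<bar> occ_number m V Q n \<omega> = t) =
     (if r = 0 then 1 - \<theta> * (1 - real t / real m)
      else if r = 1 then \<theta> * (1 - real t / real m) else 0)"
proof -
  have cong: "(occupancy m u n = t) = (occupancy m v n = t)"
    if "\<And>i. i \<in> {1..n} \<Longrightarrow> u i = v i" for u v
    using occupancy_cong[OF that] by simp
  show ?thesis
    using cond_prob_history[of n "\<lambda>u. occupancy m u n = t" t r, OF cong] assms
    by (simp add: occ_number_def)
qed

text \<open>Conditioning on the current occupancy number requires an event of positive probability.
  It inherits positivity from any finer conditioning event that it contains.\<close>

lemma prob_occ_number_pos:
  assumes "prob {\<omega> \<in> space M. R \<omega>} > 0" "\<And>\<omega>. \<omega> \<in> space M \<Longrightarrow> R \<omega> \<Longrightarrow> occ_number m V Q n \<omega> = t"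
  shows "prob {\<omega> \<in> space M. occ_number m V Q n \<omega> = t} > 0"
proof -
  have "{\<omega> \<in> space M. occ_number m V Q n \<omega> = t} = occ_number m V Q n -` {t} \<inter> space M"
    by auto
  then have "{\<omega> \<in> space M. occ_number m V Q n \<omega> = t} \<in> events"
    using measurable_sets[OF measurable_occ_number] by simp
  then have "prob {\<omega> \<in> space M. R \<omega>} \<le> prob {\<omega> \<in> space M. occ_number m V Q n \<omega> = t}"
    using assms(2) by (intro finite_measure_mono) auto
  with assms(1) show ?thesis by simp
qed

text \<open>The path of occupancy numbers up to \<open>n\<close> is determined by the first
  \<open>n\<close> allocations and fixes the current value \<open>x n\<close>, so conditioning on
  the path and on the current value alone gives the same transition probability.\<close>

lemma markov_chain_occ_number:
  assumes "m \<ge> 1" "0 \<le> \<theta>" "\<theta> \<le> 1"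
  shows "markov_chain M (occ_number m V Q)"
  unfolding markov_chain_def
proof (intro conjI allI impI)
  fix n :: nat and x :: "nat \<Rightarrow> nat" and y :: nat
  assume pos: "prob {\<omega> \<in> space M. \<forall>i\<le>n. occ_number m V Q i \<omega> = x i} > 0"
  let ?P = "\<lambda>u. \<forall>i\<le>n. occupancy m u i = x i"
  have P: "?P u = ?P v" if "\<And>i. i \<in> {1..n} \<Longrightarrow> u i = v i" for u v
    using occupancy_cong[of _ u v m] that by simp
  \<comment> \<open>The transition law is stated for increments; the target \<open>y\<close>
    corresponds to the integer increment \<open>int y - int (x n)\<close>, which may be
    negative.\<close>
  have eq: "(int (occ_number m V Q (Suc n) \<omega>) = int y - int (x n) + int (x n)) =
      (occ_number m V Q (Suc n) \<omega> = y)" for \<omega>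
    by simp
  have "\<P>(\<omega> in M. int (occ_number m V Q (Suc n) \<omega>) = int y - int (x n) + int (x n) \<bar>
        \<forall>i\<le>n. occ_number m V Q i \<omega> = x i) =
      \<P>(\<omega> in M. int (occ_number m V Q (Suc n) \<omega>) = int y - int (x n) + int (x n) \<bar>
        occ_number m V Q n \<omega> = x n)"
    using cond_prob_history[of n ?P "x n" "int y - int (x n)", OF P]
      cond_prob_occ_number[of n "x n" "int y - int (x n)"]
      prob_occ_number_pos[OF pos, of n "x n"] pos assms
    by (simp add: occ_number_def)
  then show "\<P>(\<omega> in M. occ_number m V Q (Suc n) \<omega> = y \<bar> \<forall>i\<le>n. occ_number m V Q i \<omega> = x i) =
      \<P>(\<omega> in M. occ_number m V Q (Suc n) \<omega> = y \<bar> occ_number m V Q n \<omega> = x n)"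
    unfolding eq .
qed (rule prob_space_axioms measurable_occ_number)+

end

theorem theorem1:
  fixes M :: "'a measure" and m :: nat and \<theta> :: real
    and V :: "nat \<Rightarrow> 'a \<Rightarrow> nat" and Q :: "nat \<Rightarrow> 'a \<Rightarrow> nat"
  assumes "m \<ge> 1" and "0 < \<theta>" and "\<theta> \<le> 1"
    and "extended_occupancy_process M m \<theta> V Q"
  shows "(\<forall>(n::nat) (u :: nat \<Rightarrow> nat option) (t::nat) (r::int).
            measure M {\<omega> \<in> space M. \<forall>i\<in>{1..n}. alloc V Q i \<omega> = u i} > 0 \<longrightarrow>
            t = occupancy m u n \<longrightarrow>
              \<P>(\<omega> in M. int (occ_number m V Q (n + 1) \<omega>) = r + int t
                 \<bar> \<forall>i\<in>{1..n}. alloc V Q i \<omega> = u i) =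
              \<P>(\<omega> in M. int (occ_number m V Q (n + 1) \<omega>) = r + int t
                 \<bar> occ_number m V Q n \<omega> = t) \<and>
              \<P>(\<omega> in M. int (occ_number m V Q (n + 1) \<omega>) = r + int t
                 \<bar> occ_number m V Q n \<omega> = t) =
              (if r = 0 then 1 - \<theta> * (1 - real t / real m)
               else if r = 1 then \<theta> * (1 - real t / real m)
               else 0)) \<and>
         markov_chain M (occ_number m V Q)"
proof -
  interpret extended_occupancy_process M m \<theta> V Q by fact
  show ?thesis
  proof (rule conjI, intro allI impI)
    fix n t :: nat and u :: "nat \<Rightarrow> nat option" and r :: int
    assume pos: "prob {\<omega> \<in> space M. \<forall>i\<in>{1..n}. alloc V Q i \<omega> = u i} > 0"
      and t: "t = occupancy m u n"
    let ?c = "if r = 0 then 1 - \<theta> * (1 - real t / real m)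
               else if r = 1 then \<theta> * (1 - real t / real m) else 0"
    have occ: "occupancy m v n = t" if "\<forall>i\<in>{1..n}. v i = u i" for v
      unfolding t using that by (intro occupancy_cong) auto
    have "\<P>(\<omega> in M. int (occ_number m V Q (Suc n) \<omega>) = r + int t
        \<bar> \<forall>i\<in>{1..n}. alloc V Q i \<omega> = u i) = ?c"
      \<comment> \<open>Here the conditioning event is the single history \<open>u\<close>, on which
        \<open>occ\<close> makes the occupancy constantly \<open>t\<close>.\<close>
      by (rule cond_prob_history[where P = "\<lambda>v. \<forall>i\<in>{1..n}. v i = u i"]) (use assms occ pos in auto)
    moreover have "\<P>(\<omega> in M. int (occ_number m V Q (Suc n) \<omega>) = r + int t
        \<bar> occ_number m V Q n \<omega> = t) = ?c"
    proof (rule cond_prob_occ_number)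
      show "prob {\<omega> \<in> space M. occ_number m V Q n \<omega> = t} > 0"
        by (rule prob_occ_number_pos[OF pos]) (simp add: occ_number_def occ)
    qed (use assms in auto)
    ultimately show "\<P>(\<omega> in M. int (occ_number m V Q (n + 1) \<omega>) = r + int t
                 \<bar> \<forall>i\<in>{1..n}. alloc V Q i \<omega> = u i) =
              \<P>(\<omega> in M. int (occ_number m V Q (n + 1) \<omega>) = r + int t
                 \<bar> occ_number m V Q n \<omega> = t) \<and>
              \<P>(\<omega> in M. int (occ_number m V Q (n + 1) \<omega>) = r + int t
                 \<bar> occ_number m V Q n \<omega> = t) = ?c"
      by simp
  next
    show "markov_chain M (occ_number m V Q)"
      using assms by (intro markov_chain_occ_number) auto
  qed
qed

end
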